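(* On an $\mathcal{S}$-manifold $(M^{2n+s}, \phi,\xi_i, \eta_j, g)$ the scalar curvature $\mathrm{Scal}^{\nabla}$ of the characteristic connection $\nabla$ is related to the Riemannian scalar curvature $\mathrm{Scal}^g$ by the formula $$\mathrm{Scal}^{\nabla}=\mathrm{Scal}^g-6ns.$$
   Context: A metric $f$-manifold $(M^{2n+s},\phi,\xi_i,\eta_j,g)$ is a smooth connected manifold of dimension $2n+s$ with an endomorphism $\phi$ of $TM$ of constant rank $2n$, global vector fields $\xi_1,\dots,\xi_s$, 1-forms $\eta_1,\dots,\eta_s$ and a Riemannian metric $g$ such that $\mathrm{Ker}(\phi)=\langle\xi_1,\dots,\xi_s\rangle$, $\eta_i(\xi_j)=\delta_{ij}$, $\eta_i\circ\phi=0$, $\phi^2=-\mathrm{Id}+\sum_{i=1}^s\eta_i\otimes\xi_i$, and $g(\phi X,\phi Y)=g(X,Y)-\sum_{i=1}^s\eta_i(X)\eta_i(Y)$. Set $F(X,Y)=g(X,\phi Y)$ and $N^{(1)}=N_\phi+\sum_i d\eta_i\otimes\xi_i$, where $N_\phi(X,Y)=[\phi X,\phi Y]+\phi^2[X,Y]-\phi[X,\phi Y]-\phi[\phi X,Y]$ and $d\eta(X,Y)=X\eta(Y)-Y\eta(X)-\eta([X,Y])$. It is an $\mathcal{S}$-manifold if $s\ge1$, $2F=d\eta_j$ for all $j$, and $N^{(1)}=0$. The characteristic connection of an $\mathcal{S}$-manifold is the metric connection $\nabla=\nabla^g+\frac12T$, i.e. $\nabla_XY=\nabla^g_XY+\frac12T(X,Y)$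 with $\nabla^g$ the Levi-Civita connection, with totally skew-symmetric torsion $T=\sum_{i}\eta_i\wedge d\eta_i$, equivalently $T(X,Y)=2\sum_{i}\{F(X,Y)\xi_i-\eta_i(X)\phi(Y)+\eta_i(Y)\phi(X)\}$. It is the unique metric connection with skew-torsion satisfying $\nabla\phi=0$, $\nabla\xi_i=0$, $\nabla\eta_j=0$, and it satisfies $\nabla T=0$. Curvature convention: $R(X,Y)Z=\nabla_X\nabla_YZ-\nabla_Y\nabla_XZ-\nabla_{[X,Y]}Z$, $\mathrm{Ric}(U,V)=\sum_{a=1}^{2n+s}g(R(U,e_a)e_a,V)$ and $\mathrm{Scal}=\sum_a\mathrm{Ric}(e_a,e_a)$ for a local $g$-orthonormal frame $\{e_a\}$, applied to $\nabla$ and to $\nabla^g$. *)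

theory Defs
  imports "HOL-Analysis.Analysis" "HOL-Library.Function_Algebras"
begin

section \<open>Functions into a real vector space\<close>

text \<open>Tangent vectors are functionals on functions and vector fields are families of those;
  the pointwise operations make both of them elements of a real vector space, so that
  \<open>span\<close> and \<open>dim\<close> apply.\<close>

instantiation "fun" :: (type, scaleR) scaleR
begin

definition scaleR_fun_def: "c *\<^sub>R f = (\<lambda>x. c *\<^sub>R f x)"

instance ..

end

lemma scaleR_fun_apply [simp]: "(c *\<^sub>R f) x = c *\<^sub>R f x"
  by (simp add: scaleR_fun_def)

instance "fun" :: (type, real_vector) real_vector
  by standard (auto simp: scaleR_fun_def fun_eq_iff algebra_simps)


section \<open>Smooth manifolds\<close>

text \<open>\<open>C\<^sup>k\<close> on an open subset of a Euclidean space, by iterated directional derivatives.\<close>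

fun Ck_on :: "nat \<Rightarrow> 'b::euclidean_space set \<Rightarrow> ('b \<Rightarrow> 'c::real_normed_vector) \<Rightarrow> bool" where
  "Ck_on 0 S f \<longleftrightarrow> continuous_on S f"
| "Ck_on (Suc k) S f \<longleftrightarrow>
     (\<forall>x\<in>S. f differentiable (at x)) \<and>
     (\<forall>v. Ck_on k S (\<lambda>x. frechet_derivative f (at x) v))"

definition smooth_on :: "'b::euclidean_space set \<Rightarrow> ('b \<Rightarrow> 'c::real_normed_vector) \<Rightarrow> bool" where
  "smooth_on S f \<longleftrightarrow> (\<forall>k. Ck_on k S f)"

text \<open>A chart is a pair of its domain and its coordinate map; the values of the coordinate map
  outside the domain are irrelevant.\<close>

type_synonym ('a, 'b) chart = "'a set \<times> ('a \<Rightarrow> 'b)"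

definition smooth_atlas ::
    "('a::topological_space, 'b::euclidean_space) chart set \<Rightarrow> bool" where
  "smooth_atlas A \<longleftrightarrow>
     (\<Union>(U, c)\<in>A. U) = UNIV \<and>
     (\<forall>(U, c)\<in>A. open U \<and> open (c ` U) \<and> homeomorphism U (c ` U) c (inv_into U c)) \<and>
     (\<forall>(U, c)\<in>A. \<forall>(V, d)\<in>A. smooth_on (c ` (U \<inter> V)) (d \<circ> inv_into U c))"

text \<open>The underlying space of the manifold is the whole type \<open>'a\<close>; its dimension is
  \<open>DIM('b)\<close>. The type classes make it Hausdorff and second countable.\<close>

definition connected_smooth_manifold ::
    "('a::{t2_space, second_countable_topology}, 'b::euclidean_space) chart set \<Rightarrow> bool" where
  "connected_smooth_manifold A \<longleftrightarrow> smooth_atlas A \<and> connected (UNIV :: 'a set)"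

definition smooth_functions ::
    "('a::topological_space, 'b::euclidean_space) chart set \<Rightarrow> ('a \<Rightarrow> real) set" where
  "smooth_functions A = {f. \<forall>(U, c)\<in>A. smooth_on (c ` U) (f \<circ> inv_into U c)}"


section \<open>Tangent vectors, vector fields and tensor fields\<close>

text \<open>Tangent vectors at \<open>p\<close> are the derivations at \<open>p\<close> of the algebra of smooth functions.
  As a functional on all functions such a derivation is extended by \<open>0\<close> to the non-smooth ones,
  so that equality of tangent vectors is equality of functionals.\<close>

type_synonym 'a tvec = "('a \<Rightarrow> real) \<Rightarrow> real"
type_synonym 'a vfield = "'a \<Rightarrow> 'a tvec"

definition tangent_space ::
    "('a::topological_space, 'b::euclidean_space) chart set \<Rightarrow> 'a \<Rightarrow> 'a tvec set" where
  "tangent_space A p = {v.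
     (\<forall>f\<in>smooth_functions A. \<forall>h\<in>smooth_functions A. v (\<lambda>x. f x + h x) = v f + v h) \<and>
     (\<forall>c. \<forall>f\<in>smooth_functions A. v (\<lambda>x. c * f x) = c * v f) \<and>
     (\<forall>f\<in>smooth_functions A. \<forall>h\<in>smooth_functions A.
        v (\<lambda>x. f x * h x) = f p * v h + h p * v f) \<and>
     (\<forall>f. f \<notin> smooth_functions A \<longrightarrow> v f = 0)}"

definition vector_fields ::
    "('a::topological_space, 'b::euclidean_space) chart set \<Rightarrow> 'a vfield set" where
  "vector_fields A = {X. (\<forall>p. X p \<in> tangent_space A p) \<and>
     (\<forall>f\<in>smooth_functions A. (\<lambda>p. X p f) \<in> smooth_functions A)}"

definition fscale :: "('a \<Rightarrow> real) \<Rightarrow> 'a vfield \<Rightarrow> 'a vfield" where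
  "fscale f X = (\<lambda>p. f p *\<^sub>R X p)"

text \<open>\<open>[X, Y] f = X (Y f) - Y (X f)\<close>; for non-smooth \<open>f\<close> and vector fields \<open>X\<close>, \<open>Y\<close> both terms
  vanish, in accordance with the convention for tangent vectors.\<close>

definition lie_bracket :: "'a vfield \<Rightarrow> 'a vfield \<Rightarrow> 'a vfield" where
  "lie_bracket X Y = (\<lambda>p f. X p (\<lambda>q. Y q f) - Y p (\<lambda>q. X q f))"

definition real_linear_on :: "'v::real_vector set \<Rightarrow> ('v \<Rightarrow> 'w::real_vector) \<Rightarrow> bool" where
  "real_linear_on V f \<longleftrightarrow>
     (\<forall>u\<in>V. \<forall>v\<in>V. f (u + v) = f u + f v) \<and> (\<forall>c. \<forall>v\<in>V. f (c *\<^sub>R v) = c *\<^sub>R f v)"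

definition one_form ::
    "('a::topological_space, 'b::euclidean_space) chart set \<Rightarrow> ('a \<Rightarrow> 'a tvec \<Rightarrow> real) \<Rightarrow> bool" where
  "one_form A \<alpha> \<longleftrightarrow>
     (\<forall>p. real_linear_on (tangent_space A p) (\<alpha> p)) \<and>
     (\<forall>X\<in>vector_fields A. (\<lambda>p. \<alpha> p (X p)) \<in> smooth_functions A)"

definition endomorphism_field ::
    "('a::topological_space, 'b::euclidean_space) chart set \<Rightarrow> ('a \<Rightarrow> 'a tvec \<Rightarrow> 'a tvec) \<Rightarrow> bool" where
  "endomorphism_field A \<phi> \<longleftrightarrow>
     (\<forall>p. real_linear_on (tangent_space A p) (\<phi> p) \<and>
          \<phi> p ` tangent_space A p \<subseteq> tangent_space A p) \<and>
     (\<forall>X\<in>vector_fields A. (\<lambda>p. \<phi> p (X p)) \<in> vector_fields A)"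

definition riemannian_metric ::
    "('a::topological_space, 'b::euclidean_space) chart set \<Rightarrow>
      ('a \<Rightarrow> 'a tvec \<Rightarrow> 'a tvec \<Rightarrow> real) \<Rightarrow> bool" where
  "riemannian_metric A g \<longleftrightarrow>
     (\<forall>p. \<forall>u\<in>tangent_space A p. real_linear_on (tangent_space A p) (g p u)) \<and>
     (\<forall>p. \<forall>u\<in>tangent_space A p. \<forall>v\<in>tangent_space A p. g p u v = g p v u) \<and>
     (\<forall>p. \<forall>u\<in>tangent_space A p. u \<noteq> 0 \<longrightarrow> g p u u > 0) \<and>
     (\<forall>X\<in>vector_fields A. \<forall>Y\<in>vector_fields A. (\<lambda>p. g p (X p) (Y p)) \<in> smooth_functions A)"

definition ext_deriv ::
    "('a \<Rightarrow> 'a tvec \<Rightarrow> real) \<Rightarrow> 'a vfield \<Rightarrow> 'a vfield \<Rightarrow> 'a \<Rightarrow> real" where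
  "ext_deriv \<alpha> X Y p =
     X p (\<lambda>q. \<alpha> q (Y q)) - Y p (\<lambda>q. \<alpha> q (X q)) - \<alpha> p (lie_bracket X Y p)"

text \<open>\<open>\<alpha> \<and> d\<alpha>\<close>, with the same normalisation (no factor \<open>1/2\<close>) as in \<open>ext_deriv\<close>.\<close>

definition wedge_ext_deriv ::
    "('a \<Rightarrow> 'a tvec \<Rightarrow> real) \<Rightarrow> 'a vfield \<Rightarrow> 'a vfield \<Rightarrow> 'a vfield \<Rightarrow> 'a \<Rightarrow> real" where
  "wedge_ext_deriv \<alpha> X Y Z p =
     \<alpha> p (X p) * ext_deriv \<alpha> Y Z p + \<alpha> p (Y p) * ext_deriv \<alpha> Z X p
     + \<alpha> p (Z p) * ext_deriv \<alpha> X Y p"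


section \<open>Metric f-manifolds and S-manifolds\<close>

text \<open>The fields \<open>\<xi>\<^sub>1, \<dots>, \<xi>\<^sub>s\<close> and the forms \<open>\<eta>\<^sub>1, \<dots>, \<eta>\<^sub>s\<close> are indexed by \<open>{..<s}\<close>.\<close>

definition metric_f_manifold ::
    "('a::{t2_space, second_countable_topology}, 'b::euclidean_space) chart set \<Rightarrow> nat \<Rightarrow> nat \<Rightarrow>
      ('a \<Rightarrow> 'a tvec \<Rightarrow> 'a tvec) \<Rightarrow> (nat \<Rightarrow> 'a vfield) \<Rightarrow> (nat \<Rightarrow> 'a \<Rightarrow> 'a tvec \<Rightarrow> real) \<Rightarrow>
      ('a \<Rightarrow> 'a tvec \<Rightarrow> 'a tvec \<Rightarrow> real) \<Rightarrow> bool" where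
  "metric_f_manifold A n s \<phi> \<xi> \<eta> g \<longleftrightarrow>
     connected_smooth_manifold A \<and> DIM('b) = 2 * n + s \<and>
     endomorphism_field A \<phi> \<and> (\<forall>p. dim (\<phi> p ` tangent_space A p) = 2 * n) \<and>
     (\<forall>i<s. \<xi> i \<in> vector_fields A) \<and> (\<forall>i<s. one_form A (\<eta> i)) \<and> riemannian_metric A g \<and>
     (\<forall>p. {v \<in> tangent_space A p. \<phi> p v = 0} = span ((\<lambda>i. \<xi> i p) ` {..<s})) \<and>
     (\<forall>p. \<forall>i<s. \<forall>j<s. \<eta> i p (\<xi> j p) = (if i = j then 1 else 0)) \<and>
     (\<forall>p. \<forall>v\<in>tangent_space A p. \<forall>i<s. \<eta> i p (\<phi> p v) = 0) \<and>
     (\<forall>p. \<forall>v\<in>tangent_space A p. \<phi> p (\<phi> p v) = - v + (\<Sum>i<s. \<eta> i p v *\<^sub>R \<xi> i p)) \<and>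
     (\<forall>p. \<forall>u\<in>tangent_space A p. \<forall>v\<in>tangent_space A p.
        g p (\<phi> p u) (\<phi> p v) = g p u v - (\<Sum>i<s. \<eta> i p u * \<eta> i p v))"

definition fundamental_form ::
    "('a \<Rightarrow> 'a tvec \<Rightarrow> 'a tvec \<Rightarrow> real) \<Rightarrow> ('a \<Rightarrow> 'a tvec \<Rightarrow> 'a tvec) \<Rightarrow>
      'a vfield \<Rightarrow> 'a vfield \<Rightarrow> 'a \<Rightarrow> real" where
  "fundamental_form g \<phi> X Y p = g p (X p) (\<phi> p (Y p))"

definition nijenhuis ::
    "('a \<Rightarrow> 'a tvec \<Rightarrow> 'a tvec) \<Rightarrow> 'a vfield \<Rightarrow> 'a vfield \<Rightarrow> 'a vfield" where
  "nijenhuis \<phi> X Y = (\<lambda>p.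
     lie_bracket (\<lambda>q. \<phi> q (X q)) (\<lambda>q. \<phi> q (Y q)) p
     + \<phi> p (\<phi> p (lie_bracket X Y p))
     - \<phi> p (lie_bracket X (\<lambda>q. \<phi> q (Y q)) p)
     - \<phi> p (lie_bracket (\<lambda>q. \<phi> q (X q)) Y p))"

definition normality_tensor ::
    "nat \<Rightarrow> ('a \<Rightarrow> 'a tvec \<Rightarrow> 'a tvec) \<Rightarrow> (nat \<Rightarrow> 'a vfield) \<Rightarrow>
      (nat \<Rightarrow> 'a \<Rightarrow> 'a tvec \<Rightarrow> real) \<Rightarrow> 'a vfield \<Rightarrow> 'a vfield \<Rightarrow> 'a vfield" where
  "normality_tensor s \<phi> \<xi> \<eta> X Y =
     nijenhuis \<phi> X Y + (\<Sum>i<s. fscale (ext_deriv (\<eta> i) X Y) (\<xi> i))"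

definition S_manifold ::
    "('a::{t2_space, second_countable_topology}, 'b::euclidean_space) chart set \<Rightarrow> nat \<Rightarrow> nat \<Rightarrow>
      ('a \<Rightarrow> 'a tvec \<Rightarrow> 'a tvec) \<Rightarrow> (nat \<Rightarrow> 'a vfield) \<Rightarrow> (nat \<Rightarrow> 'a \<Rightarrow> 'a tvec \<Rightarrow> real) \<Rightarrow>
      ('a \<Rightarrow> 'a tvec \<Rightarrow> 'a tvec \<Rightarrow> real) \<Rightarrow> bool" where
  "S_manifold A n s \<phi> \<xi> \<eta> g \<longleftrightarrow>
     metric_f_manifold A n s \<phi> \<xi> \<eta> g \<and> s \<ge> 1 \<and>
     (\<forall>j<s. \<forall>X\<in>vector_fields A. \<forall>Y\<in>vector_fields A. \<forall>p.
        2 * fundamental_form g \<phi> X Y p = ext_deriv (\<eta> j) X Y p) \<and>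
     (\<forall>X\<in>vector_fields A. \<forall>Y\<in>vector_fields A. normality_tensor s \<phi> \<xi> \<eta> X Y = 0)"


section \<open>Connections\<close>

type_synonym 'a connection = "'a vfield \<Rightarrow> 'a vfield \<Rightarrow> 'a vfield"

definition affine_connection ::
    "('a::topological_space, 'b::euclidean_space) chart set \<Rightarrow> 'a connection \<Rightarrow> bool" where
  "affine_connection A D \<longleftrightarrow>
     (\<forall>X\<in>vector_fields A. \<forall>Y\<in>vector_fields A. D X Y \<in> vector_fields A) \<and>
     (\<forall>X\<in>vector_fields A. \<forall>Y\<in>vector_fields A. \<forall>Z\<in>vector_fields A.
        D (X + Y) Z = D X Z + D Y Z \<and> D X (Y + Z) = D X Y + D X Z) \<and>
     (\<forall>f\<in>smooth_functions A. \<forall>X\<in>vector_fields A. \<forall>Y\<in>vector_fields A.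
        D (fscale f X) Y = fscale f (D X Y) \<and>
        D X (fscale f Y) = fscale f (D X Y) + fscale (\<lambda>p. X p f) Y)"

definition metric_connection ::
    "('a::topological_space, 'b::euclidean_space) chart set \<Rightarrow>
      ('a \<Rightarrow> 'a tvec \<Rightarrow> 'a tvec \<Rightarrow> real) \<Rightarrow> 'a connection \<Rightarrow> bool" where
  "metric_connection A g D \<longleftrightarrow> affine_connection A D \<and>
     (\<forall>X\<in>vector_fields A. \<forall>Y\<in>vector_fields A. \<forall>Z\<in>vector_fields A. \<forall>p.
        X p (\<lambda>q. g q (Y q) (Z q)) = g p (D X Y p) (Z p) + g p (Y p) (D X Z p))"

definition torsion :: "'a connection \<Rightarrow> 'a vfield \<Rightarrow> 'a vfield \<Rightarrow> 'a vfield" where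
  "torsion D X Y = D X Y - D Y X - lie_bracket X Y"

definition levi_civita ::
    "('a::topological_space, 'b::euclidean_space) chart set \<Rightarrow>
      ('a \<Rightarrow> 'a tvec \<Rightarrow> 'a tvec \<Rightarrow> real) \<Rightarrow> 'a connection \<Rightarrow> bool" where
  "levi_civita A g D \<longleftrightarrow> metric_connection A g D \<and>
     (\<forall>X\<in>vector_fields A. \<forall>Y\<in>vector_fields A. torsion D X Y = 0)"

text \<open>\<open>D = Dg + T/2\<close>, where the torsion \<open>T\<close> of \<open>D\<close>, turned into a tensor of type \<open>(0, 3)\<close> by
  means of \<open>g\<close>, is the 3-form \<open>\<Sum>i. \<eta>\<^sub>i \<and> d\<eta>\<^sub>i\<close>; here \<open>Dg\<close> is the Levi-Civita connection.\<close>

definition characteristic_connection ::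
    "('a::topological_space, 'b::euclidean_space) chart set \<Rightarrow> nat \<Rightarrow>
      (nat \<Rightarrow> 'a \<Rightarrow> 'a tvec \<Rightarrow> real) \<Rightarrow> ('a \<Rightarrow> 'a tvec \<Rightarrow> 'a tvec \<Rightarrow> real) \<Rightarrow>
      'a connection \<Rightarrow> 'a connection \<Rightarrow> bool" where
  "characteristic_connection A s \<eta> g Dg D \<longleftrightarrow> metric_connection A g D \<and>
     (\<forall>X\<in>vector_fields A. \<forall>Y\<in>vector_fields A.
        D X Y = Dg X Y + (1 / 2) *\<^sub>R torsion D X Y \<and>
        (\<forall>Z\<in>vector_fields A. \<forall>p.
           g p (torsion D X Y p) (Z p) = (\<Sum>i<s. wedge_ext_deriv (\<eta> i) X Y Z p)))"


section \<open>Curvature\<close>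

definition curvature :: "'a connection \<Rightarrow> 'a vfield \<Rightarrow> 'a vfield \<Rightarrow> 'a vfield \<Rightarrow> 'a vfield" where
  "curvature D X Y Z = D X (D Y Z) - D Y (D X Z) - D (lie_bracket X Y) Z"

text \<open>A local orthonormal frame on \<open>U\<close>, given by vector fields on the whole manifold, to which
  connections can be applied. This is no restriction: near any point of \<open>U\<close>, a local frame
  agrees with its product by a bump function, which extends by zero, and curvature is local.\<close>

definition local_orthonormal_frame ::
    "('a::topological_space, 'b::euclidean_space) chart set \<Rightarrow>
      ('a \<Rightarrow> 'a tvec \<Rightarrow> 'a tvec \<Rightarrow> real) \<Rightarrow> 'a set \<Rightarrow> (nat \<Rightarrow> 'a vfield) \<Rightarrow> bool" where
  "local_orthonormal_frame A g U e \<longleftrightarrow>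
     open U \<and> (\<forall>a<DIM('b). e a \<in> vector_fields A) \<and>
     (\<forall>p\<in>U. (\<forall>a<DIM('b). \<forall>b<DIM('b). g p (e a p) (e b p) = (if a = b then 1 else 0)) \<and>
             span ((\<lambda>a. e a p) ` {..<DIM('b)}) = tangent_space A p)"

definition ricci ::
    "('a \<Rightarrow> 'a tvec \<Rightarrow> 'a tvec \<Rightarrow> real) \<Rightarrow> 'a connection \<Rightarrow> nat \<Rightarrow> (nat \<Rightarrow> 'a vfield) \<Rightarrow>
      'a vfield \<Rightarrow> 'a vfield \<Rightarrow> 'a \<Rightarrow> real" where
  "ricci g D m e X Y p = (\<Sum>a<m. g p (curvature D X (e a) (e a) p) (Y p))"

definition scalar_curvature ::
    "('a \<Rightarrow> 'a tvec \<Rightarrow> 'a tvec \<Rightarrow> real) \<Rightarrow> 'a connection \<Rightarrow> nat \<Rightarrow> (nat \<Rightarrow> 'a vfield) \<Rightarrow>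
      'a \<Rightarrow> real" where
  "scalar_curvature g D m e p = (\<Sum>a<m. ricci g D m e (e a) (e a) p)"

end

theory Submission
  imports Defs
begin

(* For a metric connection D = Dg + T/2 with totally skew torsion T, comparing the sectional
   terms of the two curvatures gives
     g(R(X,Y)Y, X) = g(Rg(X,Y)Y, X) - |T(X,Y)|^2 / 4
   for all fields X, Y: after pairing with X, all derivatives of T drop out by skewness.
   Hence Scal = Scal_g - (1/4) sum_{a,b} |T(e_a,e_b)|^2. Writing xi = sum_i xi_i and
   eta = sum_i eta_i, here T(u,v) = 2 F(u,v) xi - 2 eta(u) phi v + 2 eta(v) phi u, and Parseval's
   identity yields 24 n s for the sum. *)

section \<open>Smooth functions and vector fields\<close>

text \<open>Openness of \<open>S\<close> makes \<open>f\<close> and \<open>h\<close> agree near each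
  point of \<open>S\<close>, so they share their derivative there and the induction on
  \<open>k\<close> passes to it.\<close>

lemma Ck_on_cong:
  assumes "open S" "\<And>x. x \<in> S \<Longrightarrow> f x = h x" "Ck_on k S f"
  shows "Ck_on k S h"
  using assms
proof (induction k arbitrary: f h)
  case 0
  then show ?case by (simp cong: continuous_on_cong)
next
  case (Suc k)
  have deriv: "(h has_derivative frechet_derivative f (at x)) (at x)" if "x \<in> S" for x
  proof -
    have "(f has_derivative frechet_derivative f (at x)) (at x)"
      using Suc.prems(3) that frechet_derivative_works by auto
    then show ?thesis
      using has_derivative_transform_within_open Suc.prems(1,2) that by metis
  qed
  have "Ck_on k S (\<lambda>x. frechet_derivative h (at x) v)" for v
  proof (rule Suc.IH[OF Suc.prems(1)])
    show "Ck_on k S (\<lambda>x. frechet_derivative f (at x) v)"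
      using Suc.prems(3) by simp
    show "frechet_derivative f (at x) v = frechet_derivative h (at x) v" if "x \<in> S" for x
      using frechet_derivative_at[OF deriv[OF that]] by simp
  qed
  moreover have "h differentiable (at x)" if "x \<in> S" for x
    using deriv[OF that] by (rule differentiableI)
  ultimately show ?case by simp
qed

text \<open>The derivative of the difference is known to be the difference of the derivatives only
  on \<open>S\<close>; \<open>Ck_on_cong\<close> bridges this in the induction.\<close>

lemma Ck_on_diff:
  assumes "open S" "Ck_on k S f" "Ck_on k S h"
  shows "Ck_on k S (\<lambda>x. f x - h x)"
  using assms
proof (induction k arbitrary: f h)
  case 0
  then show ?case by (simp add: continuous_on_diff)
next
  case (Suc k)
  have deriv: "((\<lambda>x. f x - h x) has_derivative
      (\<lambda>v. frechet_derivative f (at x) v - frechet_derivative h (at x) v)) (at x)"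
    if "x \<in> S" for x
    using Suc.prems(2,3) that
    by (intro has_derivative_diff) (simp_all add: frechet_derivative_works[symmetric])
  have "Ck_on k S (\<lambda>x. frechet_derivative (\<lambda>x. f x - h x) (at x) v)" for v
  proof (rule Ck_on_cong[OF Suc.prems(1)])
    show "Ck_on k S (\<lambda>x. frechet_derivative f (at x) v - frechet_derivative h (at x) v)"
      using Suc by simp
    show "frechet_derivative f (at x) v - frechet_derivative h (at x) v
        = frechet_derivative (\<lambda>x. f x - h x) (at x) v" if "x \<in> S" for x
      using frechet_derivative_at[OF deriv[OF that]] by metis
  qed
  moreover have "(\<lambda>x. f x - h x) differentiable (at x)" if "x \<in> S" for x
    using deriv[OF that] by (rule differentiableI)
  ultimately show ?case by simp
qed

lemma smooth_functions_diff:
  assumes "smooth_atlas A" "f \<in> smooth_functions A" "h \<in> smooth_functions A"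
  shows "(\<lambda>x. f x - h x) \<in> smooth_functions A"
proof -
  have "smooth_on (c ` U) ((\<lambda>x. f x - h x) \<circ> inv_into U c)" if "(U, c) \<in> A" for U c
  proof -
    have "open (c ` U)"
      using assms(1) that by (auto simp: smooth_atlas_def)
    moreover have "smooth_on (c ` U) (f \<circ> inv_into U c)" "smooth_on (c ` U) (h \<circ> inv_into U c)"
      using assms(2,3) that by (auto simp: smooth_functions_def)
    ultimately show ?thesis
      using Ck_on_diff by (fastforce simp: smooth_on_def comp_def)
  qed
  then show ?thesis by (auto simp: smooth_functions_def)
qed

lemma subspace_tangent_space: "subspace (tangent_space A p)"
  by (auto simp: subspace_def tangent_space_def algebra_simps)

text \<open>Closure under differences makes the torsion, and the bracket in the form
  \<open>Dg X Y - Dg Y X\<close>, vector fields again.\<close>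

lemma vector_fields_diff:
  assumes "smooth_atlas A" "X \<in> vector_fields A" "Y \<in> vector_fields A"
  shows "X - Y \<in> vector_fields A"
  using assms(2,3) smooth_functions_diff[OF assms(1)]
    subspace_diff[OF subspace_tangent_space[of A]]
  by (auto simp: vector_fields_def)

lemma vector_field_in_tangent_space: "X \<in> vector_fields A \<Longrightarrow> X p \<in> tangent_space A p"
  by (simp add: vector_fields_def)

lemma lie_bracket_skew: "lie_bracket Y X = - lie_bracket X Y"
  by (simp add: lie_bracket_def fun_eq_iff)

lemma torsion_skew: "torsion D Y X = - torsion D X Y"
  using lie_bracket_skew[of Y X] by (simp add: torsion_def algebra_simps)

lemma metric_connection_closed:
  assumes "metric_connection A g D" "X \<in> vector_fields A" "Y \<in> vector_fields A"
  shows "D X Y \<in> vector_fields A"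
  using assms unfolding metric_connection_def affine_connection_def by blast


section \<open>Curvature of a metric connection with skew torsion\<close>

text \<open>The three terms of the curvature, paired with \<open>X\<close>, are compared one by one
  in facts \<open>1\<close>, \<open>2\<close> and \<open>3\<close>. The corrections of the last two
  that are linear in the torsion cancel, which leaves only the quadratic term.\<close>

lemma curvature_skew_torsion:
  fixes A :: "('a::{t2_space, second_countable_topology}, 'b::euclidean_space) chart set"
  assumes atlas: "smooth_atlas A"
    and g: "riemannian_metric A g"
    and Dg: "levi_civita A g Dg"
    and D: "metric_connection A g D"
    and D_eq: "\<And>X Y. X \<in> vector_fields A \<Longrightarrow> Y \<in> vector_fields A \<Longrightarrow>
                 D X Y = Dg X Y + (1 / 2) *\<^sub>R torsion D X Y"
    and skew: "\<And>X Y Z p. X \<in> vector_fields A \<Longrightarrow> Y \<in> vector_fields A \<Longrightarrow>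
                 Z \<in> vector_fields A \<Longrightarrow>
                 g p (torsion D X Y p) (Z p) = - g p (torsion D X Z p) (Y p)"
    and X: "X \<in> vector_fields A" and Y: "Y \<in> vector_fields A"
  shows "g p (curvature D X Y Y p) (X p)
           = g p (curvature Dg X Y Y p) (X p) - g p (torsion D X Y p) (torsion D X Y p) / 4"
proof -
  define VF where "VF = vector_fields A"
  have D_VF: "D X Y \<in> VF" if "X \<in> VF" "Y \<in> VF" for X Y
    using metric_connection_closed[OF D] that by (simp add: VF_def)
  have Dg_metric: "metric_connection A g Dg"
    using Dg by (simp add: levi_civita_def)
  have Dg_VF: "Dg X Y \<in> VF" if "X \<in> VF" "Y \<in> VF" for X Y
    using metric_connection_closed[OF Dg_metric] that by (simp add: VF_def)
  have diff_VF: "X - Y \<in> VF" if "X \<in> VF" "Y \<in> VF" for X Y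
    using vector_fields_diff[OF atlas] that by (simp add: VF_def)
  \<comment> \<open>Vanishing torsion of \<open>Dg\<close> expresses the bracket by covariant
    derivatives, so its smoothness comes from that of \<open>Dg\<close>.\<close>
  have bracket: "lie_bracket X Y = Dg X Y - Dg Y X" if "X \<in> VF" "Y \<in> VF" for X Y
  proof -
    have "torsion Dg X Y = 0"
      using Dg that unfolding levi_civita_def VF_def by blast
    then show ?thesis by (simp add: torsion_def algebra_simps)
  qed
  have bracket_VF: "lie_bracket X Y \<in> VF" if "X \<in> VF" "Y \<in> VF" for X Y
    using bracket[OF that] that by (simp add: diff_VF Dg_VF)
  have torsion_VF: "torsion D X Y \<in> VF" if "X \<in> VF" "Y \<in> VF" for X Y
    unfolding torsion_def using that by (intro diff_VF D_VF bracket_VF)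
  have tangent: "X p \<in> tangent_space A p" if "X \<in> VF" for X p
    using that by (simp add: VF_def vector_field_in_tangent_space)
  note subsp = subspace_add[OF subspace_tangent_space] subspace_diff[OF subspace_tangent_space]
    subspace_scale[OF subspace_tangent_space]
  have g_sym: "g p u v = g p v u" if "u \<in> tangent_space A p" "v \<in> tangent_space A p" for p u v
    using g that by (auto simp: riemannian_metric_def)
  have g_add: "g p u (v + w) = g p u v + g p u w"
    if "u \<in> tangent_space A p" "v \<in> tangent_space A p" "w \<in> tangent_space A p" for p u v w
    using g that by (auto simp: riemannian_metric_def real_linear_on_def)
  have g_scale: "g p u (c *\<^sub>R v) = c * g p u v"
    if "u \<in> tangent_space A p" "v \<in> tangent_space A p" for p u v c
    using g that by (auto simp: riemannian_metric_def real_linear_on_def)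
  have g_add_left: "g p (v + w) u = g p v u + g p w u"
    if "u \<in> tangent_space A p" "v \<in> tangent_space A p" "w \<in> tangent_space A p" for p u v w
    using that by (simp add: g_sym[of _ p u] g_add subsp)
  have g_scale_left: "g p (c *\<^sub>R v) u = c * g p v u"
    if "u \<in> tangent_space A p" "v \<in> tangent_space A p" for p u v c
    using that by (simp add: g_sym[of _ p u] g_scale subsp)
  have g_diff: "g p u (v - w) = g p u v - g p u w"
    if "u \<in> tangent_space A p" "v \<in> tangent_space A p" "w \<in> tangent_space A p" for p u v w
    using g_add[of u p "v - w" w] that by (simp add: subsp)
  have g_diff_left: "g p (v - w) u = g p v u - g p w u"
    if "u \<in> tangent_space A p" "v \<in> tangent_space A p" "w \<in> tangent_space A p" for p u v w
    using that by (simp add: g_sym[of _ p u] g_diff subsp)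
  \<comment> \<open>The torsion as a (0,3)-tensor. The two transpositions below, one from the
    hypothesis and one from the definition of torsion, make it totally skew.\<close>
  define h where "h X Y Z p = g p (torsion D X Y p) (Z p)" for X Y Z p
  have h23: "h X Y Z p = - h X Z Y p" if "X \<in> VF" "Y \<in> VF" "Z \<in> VF" for X Y Z p
    using skew[of X Y Z p] that by (simp add: h_def VF_def)
  have h12: "h X Y Z p = - h Y X Z p" if "X \<in> VF" "Y \<in> VF" "Z \<in> VF" for X Y Z p
    using g_scale_left[of "Z p" p "torsion D X Y p" "- 1"] that
    by (simp add: h_def torsion_skew[of D Y X] tangent torsion_VF)
  have gD: "g p (D U V p) (Z p) = g p (Dg U V p) (Z p) + h U V Z p / 2"
    if "U \<in> VF" "V \<in> VF" "Z \<in> VF" for U V Z p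
    using that D_eq[of U V]
    by (simp add: VF_def[symmetric] g_add_left g_scale_left tangent Dg_VF torsion_VF subsp h_def)
  have XY: "X \<in> VF" "Y \<in> VF" using X Y by (simp_all add: VF_def)
  have curv: "g p (curvature E X Y Y p) (X p) = g p (E X (E Y Y) p) (X p)
        - g p (E Y (E X Y) p) (X p) - g p (E (lie_bracket X Y) Y p) (X p)"
    if "\<And>X Y. X \<in> VF \<Longrightarrow> Y \<in> VF \<Longrightarrow> E X Y \<in> VF" for E
    using that XY by (simp add: curvature_def g_diff_left tangent bracket_VF subsp)
  have "torsion D Y Y = 0"
    by (simp add: torsion_def lie_bracket_def fun_eq_iff)
  then have "D Y Y = Dg Y Y" using D_eq Y by simp
  \<comment> \<open>By \<open>h12\<close> this is minus a value with \<open>X\<close> in the last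
    two slots, which \<open>h23\<close> makes zero.\<close>
  moreover have "h X (Dg Y Y) X p = 0"
    using h12[of X "Dg Y Y" X p] h23[of "Dg Y Y" X X p] XY by (simp add: Dg_VF)
  ultimately have 1: "g p (D X (D Y Y) p) (X p) = g p (Dg X (Dg Y Y) p) (X p)"
    using gD[of X "Dg Y Y" X p] XY by (simp add: Dg_VF)
  \<comment> \<open>Compatibility with the metric trades the second covariant derivative for the
    derivative of a function and a product of first derivatives.\<close>
  have metric: "g p (E Y (E X Y) p) (X p)
      = Y p (\<lambda>q. g q (E X Y q) (X q)) - g p (E X Y p) (E Y X p)"
    if "metric_connection A g E" "E X Y \<in> VF" for E
  proof -
    have "Y p (\<lambda>q. g q (E X Y q) (X q))
        = g p (E Y (E X Y) p) (X p) + g p (E X Y p) (E Y X p)"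
      using that XY unfolding metric_connection_def VF_def by blast
    then show ?thesis by simp
  qed
  \<comment> \<open>Hence both connections lead to the same function to be differentiated along
    \<open>Y\<close>; no derivative of the torsion survives.\<close>
  have "h X Y X q = 0" for q
    using h12[of X Y X q] h23[of Y X X q] XY by simp
  then have same_derivative: "(\<lambda>q. g q (D X Y q) (X q)) = (\<lambda>q. g q (Dg X Y q) (X q))"
    using XY by (simp add: gD)
  \<comment> \<open>The torsion enters the two factors with opposite signs, whence the negative
    quadratic term.\<close>
  have "g p (D X Y p) (D Y X p) = g p (Dg X Y p) (Dg Y X p)
      + h X Y (Dg Y X) p / 2 - h X Y (Dg X Y) p / 2
      - g p (torsion D X Y p) (torsion D X Y p) / 4"
  proof -
    define B C t where "B = Dg X Y p" and "C = Dg Y X p" and "t = torsion D X Y p"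
    have *: "B \<in> tangent_space A p" "C \<in> tangent_space A p" "t \<in> tangent_space A p"
      using XY by (simp_all add: B_def C_def t_def tangent Dg_VF torsion_VF)
    have "D X Y p = B + (1 / 2) *\<^sub>R t" "D Y X p = C - (1 / 2) *\<^sub>R t"
      using D_eq[OF X Y] D_eq[OF Y X] torsion_skew[of D Y X] by (simp_all add: B_def C_def t_def)
    moreover have "g p B t = g p t B" using * by (simp add: g_sym)
    ultimately show ?thesis
      unfolding h_def B_def[symmetric] C_def[symmetric] t_def[symmetric]
      using * by (simp add: g_add_left g_diff g_scale g_scale_left subsp add_divide_distrib)
  qed
  then have 2: "g p (D Y (D X Y) p) (X p) = g p (Dg Y (Dg X Y) p) (X p)
      - h X Y (Dg Y X) p / 2 + h X Y (Dg X Y) p / 2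
      + g p (torsion D X Y p) (torsion D X Y p) / 4"
    using metric[OF D D_VF[OF XY]] metric[OF Dg_metric Dg_VF[OF XY]] same_derivative by simp
  let ?L = "lie_bracket X Y"
  \<comment> \<open>Three transpositions, so an odd permutation. Splitting the bracket then produces
    the linear terms of fact \<open>2\<close> with opposite signs.\<close>
  have "h ?L Y X p = - h X Y ?L p"
    using h12[of ?L Y X p] h23[of Y ?L X p] h12[of Y X ?L p] XY by (simp add: bracket_VF)
  also have "h X Y ?L p = h X Y (Dg X Y) p - h X Y (Dg Y X) p"
    using XY by (simp add: h_def bracket g_diff tangent Dg_VF torsion_VF)
  finally have 3: "g p (D ?L Y p) (X p) = g p (Dg ?L Y p) (X p)
      - h X Y (Dg X Y) p / 2 + h X Y (Dg Y X) p / 2"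
    using gD[of ?L Y X p] XY by (simp add: bracket_VF)
  show ?thesis
    using curv[OF D_VF] curv[OF Dg_VF] 1 2 3 by simp
qed


section \<open>Linear algebra of a metric f-structure\<close>

text \<open>The algebra at a single point, with a carrier set because the tangent spaces are sets
  that vary with the point.\<close>

locale metric_f_space =
  fixes V :: "'v::real_vector set" and g :: "'v \<Rightarrow> 'v \<Rightarrow> real" and \<phi> :: "'v \<Rightarrow> 'v"
    and \<xi> :: "nat \<Rightarrow> 'v" and \<eta> :: "nat \<Rightarrow> 'v \<Rightarrow> real" and s :: nat
  assumes subspace_V: "subspace V"
    and g_linear: "u \<in> V \<Longrightarrow> real_linear_on V (g u)"
    and g_sym: "u \<in> V \<Longrightarrow> v \<in> V \<Longrightarrow> g u v = g v u"
    and \<phi>_V: "v \<in> V \<Longrightarrow> \<phi> v \<in> V"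
    and \<xi>_V: "i < s \<Longrightarrow> \<xi> i \<in> V"
    and \<phi>_\<xi>: "i < s \<Longrightarrow> \<phi> (\<xi> i) = 0"
    and \<eta>_\<xi>: "i < s \<Longrightarrow> j < s \<Longrightarrow> \<eta> i (\<xi> j) = (if i = j then 1 else 0)"
    and \<eta>_\<phi>: "v \<in> V \<Longrightarrow> i < s \<Longrightarrow> \<eta> i (\<phi> v) = 0"
    and \<phi>_\<phi>: "v \<in> V \<Longrightarrow> \<phi> (\<phi> v) = - v + (\<Sum>i<s. \<eta> i v *\<^sub>R \<xi> i)"
    and g_\<phi>_\<phi>: "u \<in> V \<Longrightarrow> v \<in> V \<Longrightarrow> g (\<phi> u) (\<phi> v) = g u v - (\<Sum>i<s. \<eta> i u * \<eta> i v)"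
begin

lemmas V_closed = subspace_add[OF subspace_V] subspace_diff[OF subspace_V]
  subspace_scale[OF subspace_V] subspace_neg[OF subspace_V] subspace_0[OF subspace_V]

lemma g_add: "u \<in> V \<Longrightarrow> v \<in> V \<Longrightarrow> w \<in> V \<Longrightarrow> g u (v + w) = g u v + g u w"
  using g_linear by (simp add: real_linear_on_def)

lemma g_scale: "u \<in> V \<Longrightarrow> v \<in> V \<Longrightarrow> g u (c *\<^sub>R v) = c * g u v"
  using g_linear by (simp add: real_linear_on_def)

lemma g_zero: "u \<in> V \<Longrightarrow> g u 0 = 0"
  using g_scale[of u u 0] by simp

lemma g_diff: "u \<in> V \<Longrightarrow> v \<in> V \<Longrightarrow> w \<in> V \<Longrightarrow> g u (v - w) = g u v - g u w"
  using g_add[of u "v - w" w] by (simp add: V_closed)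

lemma sum_V: "(\<And>i. i < k \<Longrightarrow> f i \<in> V) \<Longrightarrow> (\<Sum>i<k. f i) \<in> V" for k :: nat
  by (intro subspace_sum[OF subspace_V]) simp

lemma g_sum:
  fixes k :: nat
  assumes "u \<in> V" "\<And>i. i < k \<Longrightarrow> f i \<in> V"
  shows "g u (\<Sum>i<k. f i) = (\<Sum>i<k. g u (f i))"
  using assms(2) by (induction k) (simp_all add: assms(1) g_zero g_add sum_V)

lemma g_add_left: "u \<in> V \<Longrightarrow> v \<in> V \<Longrightarrow> w \<in> V \<Longrightarrow> g (v + w) u = g v u + g w u"
  by (simp add: g_sym[of _ u] g_add V_closed)

lemma g_diff_left: "u \<in> V \<Longrightarrow> v \<in> V \<Longrightarrow> w \<in> V \<Longrightarrow> g (v - w) u = g v u - g w u"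
  by (simp add: g_sym[of _ u] g_diff V_closed)

lemma g_scale_left: "u \<in> V \<Longrightarrow> v \<in> V \<Longrightarrow> g (c *\<^sub>R v) u = c * g v u"
  by (simp add: g_sym[of _ u] g_scale V_closed)

text \<open>Putting \<open>\<xi> i\<close> into \<open>g_\<phi>_\<phi>\<close> kills the left side,
  as \<open>\<phi>\<close> vanishes there, and the sum collapses to one term. So
  \<open>\<eta> i\<close> is metrically dual to \<open>\<xi> i\<close>.\<close>

lemma g_\<xi>: "u \<in> V \<Longrightarrow> i < s \<Longrightarrow> g u (\<xi> i) = \<eta> i u"
  using g_\<phi>_\<phi>[of u "\<xi> i"] \<xi>_V[of i] \<phi>_V[of u]
  by (simp add: \<phi>_\<xi> g_zero \<eta>_\<xi> if_distrib cong: if_cong)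

definition F :: "'v \<Rightarrow> 'v \<Rightarrow> real" where
  "F u v = g u (\<phi> v)"

text \<open>Compatibility lets \<open>\<phi>\<close> be applied to both arguments since
  \<open>\<eta> i\<close> vanishes on its image; then \<open>\<phi>_\<phi>\<close> contributes the
  sign, its \<open>\<xi>\<close> part being orthogonal to \<open>\<phi> u\<close>.\<close>

lemma F_skew:
  assumes "u \<in> V" "v \<in> V"
  shows "F u v = - F v u"
proof -
  have "F u v = g (\<phi> u) (\<phi> (\<phi> v))"
    using g_\<phi>_\<phi>[of u "\<phi> v"] assms by (simp add: \<phi>_V \<eta>_\<phi> F_def)
  also have "\<dots> = - g (\<phi> u) v"
    using assms
    by (simp add: \<phi>_\<phi> g_diff g_sum g_scale g_\<xi> \<eta>_\<phi> \<phi>_V \<xi>_V V_closed sum_V)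
  finally show ?thesis
    using assms by (simp add: F_def g_sym \<phi>_V)
qed

text \<open>On an S-manifold all the \<open>\<eta> i\<close> have the same exterior derivative, so
  the torsion involves the \<open>\<xi> i\<close> and \<open>\<eta> i\<close> only through their
  sums.\<close>

definition \<xi>_bar :: 'v where
  "\<xi>_bar = (\<Sum>i<s. \<xi> i)"

definition \<eta>_bar :: "'v \<Rightarrow> real" where
  "\<eta>_bar u = (\<Sum>i<s. \<eta> i u)"

lemma \<xi>_bar_V: "\<xi>_bar \<in> V"
  by (simp add: \<xi>_bar_def sum_V \<xi>_V)

lemma g_\<xi>_bar: "u \<in> V \<Longrightarrow> g u \<xi>_bar = \<eta>_bar u"
  unfolding \<xi>_bar_def \<eta>_bar_def by (simp add: g_sum \<xi>_V g_\<xi>)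

lemma g_\<xi>_bar_\<xi>: "i < s \<Longrightarrow> g \<xi>_bar (\<xi> i) = 1"
  using g_\<xi>_bar[of "\<xi> i"]
  by (simp add: \<eta>_bar_def \<xi>_bar_V \<xi>_V g_sym \<eta>_\<xi> if_distrib cong: if_cong)

lemma g_\<xi>_bar_\<xi>_bar: "g \<xi>_bar \<xi>_bar = s"
  using g_sum[of \<xi>_bar s \<xi>] by (simp add: \<xi>_bar_V \<xi>_V g_\<xi>_bar_\<xi> \<xi>_bar_def[symmetric])

lemma \<eta>_bar_\<phi>: "v \<in> V \<Longrightarrow> \<eta>_bar (\<phi> v) = 0"
  by (simp add: \<eta>_bar_def \<eta>_\<phi>)

text \<open>The value at a point of the torsion of the characteristic connection.\<close>

definition \<tau> :: "'v \<Rightarrow> 'v \<Rightarrow> 'v" where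
  "\<tau> u v = (2 * F u v) *\<^sub>R \<xi>_bar - (2 * \<eta>_bar u) *\<^sub>R \<phi> v + (2 * \<eta>_bar v) *\<^sub>R \<phi> u"

lemma \<tau>_V: "u \<in> V \<Longrightarrow> v \<in> V \<Longrightarrow> \<tau> u v \<in> V"
  by (simp add: \<tau>_def V_closed \<phi>_V \<xi>_bar_V)

text \<open>Once each exterior derivative of \<open>\<eta> i\<close> equals 2F, the cyclic sum is
  the value of the sum of the 3-forms \<eta>_i \<and> d\<eta>_i; this ties \<open>\<tau>\<close> to
  the torsion.\<close>

lemma g_\<tau>:
  assumes "u \<in> V" "v \<in> V" "w \<in> V"
  shows "g (\<tau> u v) w = 2 * (\<eta>_bar u * F v w + \<eta>_bar v * F w u + \<eta>_bar w * F u v)"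
proof -
  have "g w (\<tau> u v) = 2 * (F u v * \<eta>_bar w - \<eta>_bar u * F w v + \<eta>_bar v * F w u)"
    using assms by (simp add: \<tau>_def g_diff g_add g_scale V_closed \<phi>_V \<xi>_bar_V g_\<xi>_bar F_def)
  then show ?thesis
    using assms F_skew[of w v] by (simp add: g_sym \<tau>_V algebra_simps)
qed

text \<open>The image of \<open>\<phi>\<close> is orthogonal to \<open>\<xi>_bar\<close>, so only
  the two \<open>\<phi>\<close> terms interact; the factor \<open>s\<close> is the squared norm of
  \<open>\<xi>_bar\<close>.\<close>

lemma g_\<tau>_\<tau>:
  assumes "u \<in> V" "v \<in> V"
  shows "g (\<tau> u v) (\<tau> u v) = 4 * (s * (F u v)\<^sup>2 + (\<eta>_bar u)\<^sup>2 * g (\<phi> v) (\<phi> v)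
           + (\<eta>_bar v)\<^sup>2 * g (\<phi> u) (\<phi> u) - 2 * \<eta>_bar u * \<eta>_bar v * g (\<phi> u) (\<phi> v))"
proof -
  have "g (\<phi> u) \<xi>_bar = 0" "g (\<phi> v) \<xi>_bar = 0" "g \<xi>_bar (\<phi> u) = 0" "g \<xi>_bar (\<phi> v) = 0"
    using assms g_sym[OF \<xi>_bar_V] by (simp_all add: g_\<xi>_bar \<phi>_V \<eta>_bar_\<phi>)
  moreover have "g (\<phi> v) (\<phi> u) = g (\<phi> u) (\<phi> v)"
    using assms by (simp add: g_sym \<phi>_V)
  ultimately show ?thesis
    using assms
    by (simp add: \<tau>_def g_add g_diff g_scale g_add_left g_diff_left g_scale_left V_closed
        \<phi>_V \<xi>_bar_V g_\<xi>_bar_\<xi>_bar power2_eq_square algebra_simps)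
qed

section \<open>Parseval's identity and sums over an orthonormal basis\<close>

context
  fixes e :: "nat \<Rightarrow> 'v" and m :: nat
  assumes orthonormal: "\<And>a b. a < m \<Longrightarrow> b < m \<Longrightarrow> g (e a) (e b) = (if a = b then 1 else 0)"
    and span_e: "span (e ` {..<m}) = V"
begin

lemma e_V: "a < m \<Longrightarrow> e a \<in> V"
  using span_superset[of "e ` {..<m}"] span_e by auto

lemma orthonormal_expansion:
  assumes "u \<in> V"
  shows "u = (\<Sum>a<m. g u (e a) *\<^sub>R e a)"
proof -
  have "u \<in> span (e ` {..<m})" using assms span_e by simp
  \<comment> \<open>Membership in \<open>V\<close> is carried through the induction because
    \<open>g\<close> is linear only on \<open>V\<close>.\<close>
  then have "u \<in> V \<and> u = (\<Sum>a<m. g u (e a) *\<^sub>R e a)"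
  proof (induction rule: span_induct_alt)
    case base
    have "g 0 (e a) = 0" if "a < m" for a
      using g_sym[of 0 "e a"] g_zero[of "e a"] that by (simp add: e_V V_closed)
    then show ?case by (simp add: V_closed)
  next
    case (step c x y)
    then obtain b where b: "b < m" "x = e b" by auto
    have "(\<Sum>a<m. g (c *\<^sub>R x + y) (e a) *\<^sub>R e a)
        = (\<Sum>a<m. (if a = b then c *\<^sub>R e a else 0) + g y (e a) *\<^sub>R e a)"
    proof (rule sum.cong[OF refl])
      fix a assume "a \<in> {..<m}"
      then have a: "a < m" by simp
      have "g (c *\<^sub>R x + y) (e a) = c * g (e b) (e a) + g y (e a)"
        using a b step by (simp add: g_add_left g_scale_left e_V V_closed)
      then show "g (c *\<^sub>R x + y) (e a) *\<^sub>R e a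
          = (if a = b then c *\<^sub>R e a else 0) + g y (e a) *\<^sub>R e a"
        using orthonormal[OF b(1) a] by (simp add: algebra_simps)
    qed
    also have "\<dots> = c *\<^sub>R x + y"
      using b step by (simp add: sum.distrib)
    finally show ?case
      using b step by (simp add: e_V V_closed)
  qed
  then show ?thesis by blast
qed

lemma parseval:
  assumes "u \<in> V" "v \<in> V"
  shows "(\<Sum>a<m. g u (e a) * g v (e a)) = g u v"
proof -
  have "g u v = g u (\<Sum>a<m. g v (e a) *\<^sub>R e a)"
    using orthonormal_expansion[OF assms(2)] by simp
  then show ?thesis
    using assms by (simp add: g_sum g_scale e_V V_closed mult.commute)
qed

text \<open>Each summand is 1 minus the squares of the \<open>\<eta> i (e a)\<close>. After swapping
  the sums, Parseval turns these squares into the norms of the \<open>s\<close> unit vectors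
  \<open>\<xi> i\<close>.\<close>

lemma sum_g_\<phi>_\<phi>: "(\<Sum>a<m. g (\<phi> (e a)) (\<phi> (e a))) = real m - real s"
proof -
  have "(\<Sum>a<m. g (\<phi> (e a)) (\<phi> (e a))) = (\<Sum>a<m. 1 - (\<Sum>i<s. \<eta> i (e a) * \<eta> i (e a)))"
    by (intro sum.cong refl) (simp add: g_\<phi>_\<phi> e_V orthonormal)
  also have "\<dots> = real m - (\<Sum>i<s. \<Sum>a<m. \<eta> i (e a) * \<eta> i (e a))"
    by (simp add: sum_subtractf) (rule sum.swap)
  also have "(\<Sum>i<s. \<Sum>a<m. \<eta> i (e a) * \<eta> i (e a)) = (\<Sum>i<s. 1)"
  proof (rule sum.cong[OF refl])
    fix i assume "i \<in> {..<s}"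
    then have i: "i < s" by simp
    have "(\<Sum>a<m. \<eta> i (e a) * \<eta> i (e a)) = (\<Sum>a<m. g (\<xi> i) (e a) * g (\<xi> i) (e a))"
      using i by (intro sum.cong refl) (simp add: g_\<xi>[symmetric] g_sym e_V \<xi>_V)
    then show "(\<Sum>a<m. \<eta> i (e a) * \<eta> i (e a)) = 1"
      using i by (simp add: parseval \<xi>_V g_\<xi> \<eta>_\<xi>)
  qed
  finally show ?thesis by simp
qed

text \<open>For fixed \<open>b\<close>, Parseval applied to \<open>\<phi> (e b)\<close> evaluates
  the sum over \<open>a\<close>.\<close>

lemma sum_F: "(\<Sum>a<m. \<Sum>b<m. (F (e a) (e b))\<^sup>2) = real m - real s"
proof -
  have "(\<Sum>a<m. (F (e a) (e b))\<^sup>2) = g (\<phi> (e b)) (\<phi> (e b))" if "b < m" for b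
  proof -
    have "(\<Sum>a<m. (F (e a) (e b))\<^sup>2) = (\<Sum>a<m. g (\<phi> (e b)) (e a) * g (\<phi> (e b)) (e a))"
      using that by (intro sum.cong refl) (simp add: F_def power2_eq_square g_sym e_V \<phi>_V)
    then show ?thesis using that by (simp add: parseval e_V \<phi>_V)
  qed
  then show ?thesis
    using sum_g_\<phi>_\<phi> by (subst sum.swap) simp
qed

lemma sum_\<eta>_bar: "(\<Sum>a<m. (\<eta>_bar (e a))\<^sup>2) = s"
proof -
  have "(\<Sum>a<m. (\<eta>_bar (e a))\<^sup>2) = (\<Sum>a<m. g \<xi>_bar (e a) * g \<xi>_bar (e a))"
    by (intro sum.cong refl) (simp add: power2_eq_square g_\<xi>_bar[symmetric] g_sym e_V \<xi>_bar_V)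
  then show ?thesis by (simp add: parseval \<xi>_bar_V g_\<xi>_bar_\<xi>_bar)
qed

text \<open>The numbers \<open>\<eta>_bar (e b)\<close> are the components of
  \<open>\<xi>_bar\<close>, so Parseval reduces each inner sum to a pairing of
  \<open>\<xi>_bar\<close> with the image of \<open>\<phi>\<close>, which is zero.\<close>

lemma sum_mixed: "(\<Sum>a<m. \<Sum>b<m. \<eta>_bar (e a) * \<eta>_bar (e b) * g (\<phi> (e a)) (\<phi> (e b))) = 0"
proof -
  have inner: "(\<Sum>b<m. \<eta>_bar (e b) * g (\<phi> (e a)) (\<phi> (e b))) = 0" if a: "a < m" for a
  proof -
    \<comment> \<open>This is \<open>g (\<phi> (e a)) (\<phi> \<xi>_bar)\<close>, written as \<open>- g (\<phi> (\<phi> (e a))) \<xi>_bar\<close>.\<close>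
    have "(\<Sum>b<m. \<eta>_bar (e b) * g (\<phi> (e a)) (\<phi> (e b)))
        = (\<Sum>b<m. - (g \<xi>_bar (e b) * g (\<phi> (\<phi> (e a))) (e b)))"
    proof (rule sum.cong[OF refl])
      fix b assume "b \<in> {..<m}"
      then show "\<eta>_bar (e b) * g (\<phi> (e a)) (\<phi> (e b))
          = - (g \<xi>_bar (e b) * g (\<phi> (\<phi> (e a))) (e b))"
        using F_skew[of "\<phi> (e a)" "e b"] a
        by (simp add: F_def g_\<xi>_bar[symmetric] g_sym[of \<xi>_bar] g_sym[of "\<phi> (\<phi> (e a))"]
            e_V \<phi>_V \<xi>_bar_V)
    qed
    also have "\<dots> = - g (\<phi> (\<phi> (e a))) \<xi>_bar"
      using a using parseval[of \<xi>_bar "\<phi> (\<phi> (e a))"]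
      by (simp add: sum_negf e_V \<phi>_V \<xi>_bar_V g_sym[of \<xi>_bar "\<phi> (\<phi> (e a))"])
    finally show ?thesis using a by (simp add: g_\<xi>_bar \<eta>_bar_\<phi> e_V \<phi>_V)
  qed
  have "(\<Sum>a<m. \<Sum>b<m. \<eta>_bar (e a) * \<eta>_bar (e b) * g (\<phi> (e a)) (\<phi> (e b)))
      = (\<Sum>a<m. \<eta>_bar (e a) * (\<Sum>b<m. \<eta>_bar (e b) * g (\<phi> (e a)) (\<phi> (e b))))"
    by (simp add: sum_distrib_left mult.assoc)
  then show ?thesis by (simp add: inner)
qed

text \<open>By \<open>g_\<tau>_\<tau>\<close> the \<open>F\<close> term and the two product terms
  contribute \<open>s * (m - s)\<close> each and the mixed term nothing; 12 is 4 times 3.\<close>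

lemma sum_\<tau>:
  "(\<Sum>a<m. \<Sum>b<m. g (\<tau> (e a) (e b)) (\<tau> (e a) (e b))) = 12 * real s * (real m - real s)"
proof -
  let ?\<phi>2 = "\<lambda>a. g (\<phi> (e a)) (\<phi> (e a))"
  have prod1: "(\<Sum>a<m. \<Sum>b<m. (\<eta>_bar (e a))\<^sup>2 * ?\<phi>2 b) = s * (real m - real s)"
    by (simp add: sum_product[symmetric] sum_\<eta>_bar sum_g_\<phi>_\<phi>)
  have prod2: "(\<Sum>a<m. \<Sum>b<m. (\<eta>_bar (e b))\<^sup>2 * ?\<phi>2 a) = s * (real m - real s)"
    using prod1 by (subst sum.swap)
  have "(\<Sum>a<m. \<Sum>b<m. g (\<tau> (e a) (e b)) (\<tau> (e a) (e b)))
      = (\<Sum>a<m. \<Sum>b<m. 4 * (s * (F (e a) (e b))\<^sup>2 + (\<eta>_bar (e a))\<^sup>2 * ?\<phi>2 b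
          + (\<eta>_bar (e b))\<^sup>2 * ?\<phi>2 a
          - 2 * (\<eta>_bar (e a) * \<eta>_bar (e b) * g (\<phi> (e a)) (\<phi> (e b)))))"
    by (intro sum.cong refl) (simp add: g_\<tau>_\<tau> e_V mult.assoc)
  also have "\<dots> = 4 * (s * (\<Sum>a<m. \<Sum>b<m. (F (e a) (e b))\<^sup>2)
      + (\<Sum>a<m. \<Sum>b<m. (\<eta>_bar (e a))\<^sup>2 * ?\<phi>2 b) + (\<Sum>a<m. \<Sum>b<m. (\<eta>_bar (e b))\<^sup>2 * ?\<phi>2 a)
      - 2 * (\<Sum>a<m. \<Sum>b<m. \<eta>_bar (e a) * \<eta>_bar (e b) * g (\<phi> (e a)) (\<phi> (e b))))"
    by (simp only: sum_distrib_left[symmetric] sum.distrib sum_subtractf)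
  finally show ?thesis by (simp add: sum_F prod1 prod2 sum_mixed)
qed

end

end

lemma metric_f_manifold_metric_f_space:
  assumes "metric_f_manifold A n s \<phi> \<xi> \<eta> g"
  shows "metric_f_space (tangent_space A p) (g p) (\<phi> p) (\<lambda>i. \<xi> i p) (\<lambda>i. \<eta> i p) s"
proof
  show "subspace (tangent_space A p)" by (rule subspace_tangent_space)
  \<comment> \<open>The kernel condition gives both the vanishing of \<open>\<phi>\<close> on the
    \<open>\<xi> i\<close>.and, read as a set of tangent vectors, their tangency.\<close>
  have ker: "{v \<in> tangent_space A p. \<phi> p v = 0} = span ((\<lambda>i. \<xi> i p) ` {..<s})"
    using assms by (simp add: metric_f_manifold_def)
  fix i assume "i < s"
  then have "\<xi> i p \<in> span ((\<lambda>i. \<xi> i p) ` {..<s})" by (intro span_base) simp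
  then show "\<xi> i p \<in> tangent_space A p" "\<phi> p (\<xi> i p) = 0" using ker by auto
qed (use assms in \<open>auto simp: metric_f_manifold_def riemannian_metric_def endomorphism_field_def
       vector_fields_def\<close>)


section \<open>Scalar curvature of the characteristic connection\<close>

theorem corollary3p10:
  fixes A :: "('a::{t2_space, second_countable_topology}, 'b::euclidean_space) chart set"
    and n s :: nat
    and \<phi> :: "'a \<Rightarrow> 'a tvec \<Rightarrow> 'a tvec"
    and \<xi> :: "nat \<Rightarrow> 'a vfield"
    and \<eta> :: "nat \<Rightarrow> 'a \<Rightarrow> 'a tvec \<Rightarrow> real"
    and g :: "'a \<Rightarrow> 'a tvec \<Rightarrow> 'a tvec \<Rightarrow> real"
    and Dg D :: "'a connection"
  assumes "S_manifold A n s \<phi> \<xi> \<eta> g"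
    and "levi_civita A g Dg"
    and "characteristic_connection A s \<eta> g Dg D"
  shows "\<forall>U e. local_orthonormal_frame A g U e \<longrightarrow>
           (\<forall>p\<in>U. scalar_curvature g D (2 * n + s) e p =
                   scalar_curvature g Dg (2 * n + s) e p - 6 * real n * real s)"
proof (intro allI impI ballI)
  fix U e p
  assume frame: "local_orthonormal_frame A g U e" and p: "p \<in> U"
  let ?m = "2 * n + s"
  have mf: "metric_f_manifold A n s \<phi> \<xi> \<eta> g"
    using assms(1) by (simp add: S_manifold_def)
  then have atlas: "smooth_atlas A" and metric: "riemannian_metric A g" and dim: "DIM('b) = ?m"
    by (simp_all add: metric_f_manifold_def connected_smooth_manifold_def)
  \<comment> \<open>All points \<open>q\<close> are covered, since the skewness of the torsion is
    used under derivatives.\<close>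
  interpret P: metric_f_space "tangent_space A q" "g q" "\<phi> q" "\<lambda>i. \<xi> i q" "\<lambda>i. \<eta> i q" s for q
    using mf by (rule metric_f_manifold_metric_f_space)
  note tangent = vector_field_in_tangent_space
  have torsion_\<tau>: "g q (torsion D X Y q) (Z q) = g q (P.\<tau> q (X q) (Y q)) (Z q)"
    if "X \<in> vector_fields A" "Y \<in> vector_fields A" "Z \<in> vector_fields A" for X Y Z q
  proof -
    have "ext_deriv (\<eta> i) X Y q = 2 * P.F q (X q) (Y q)"
      if "i < s" "X \<in> vector_fields A" "Y \<in> vector_fields A" for i X Y
      using assms(1) that unfolding S_manifold_def P.F_def fundamental_form_def by metis
    then have "(\<Sum>i<s. wedge_ext_deriv (\<eta> i) X Y Z q) = g q (P.\<tau> q (X q) (Y q)) (Z q)"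
      using that
      by (simp add: P.g_\<tau> tangent wedge_ext_deriv_def P.\<eta>_bar_def sum.distrib
          sum_distrib_left sum_distrib_right algebra_simps)
    moreover have "g q (torsion D X Y q) (Z q) = (\<Sum>i<s. wedge_ext_deriv (\<eta> i) X Y Z q)"
      using assms(3) that unfolding characteristic_connection_def by blast
    ultimately show ?thesis by simp
  qed
  \<comment> \<open>Exchanging \<open>Y\<close> and \<open>Z\<close> in the cyclic formula
    \<open>P.g_\<tau>\<close> permutes its terms and reverses the arguments of each
    \<open>F\<close>.\<close>
  have skew: "g q (torsion D X Y q) (Z q) = - g q (torsion D X Z q) (Y q)"
    if "X \<in> vector_fields A" "Y \<in> vector_fields A" "Z \<in> vector_fields A" for X Y Z q
  proof -
    have "P.F q (Z q) (Y q) = - P.F q (Y q) (Z q)" "P.F q (Y q) (X q) = - P.F q (X q) (Y q)"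
      "P.F q (X q) (Z q) = - P.F q (Z q) (X q)"
      using that tangent P.F_skew by blast+
    then show ?thesis
      using that by (simp add: torsion_\<tau> P.g_\<tau> tangent)
  qed
  have e: "e a \<in> vector_fields A" if "a < ?m" for a
    using frame that dim by (simp add: local_orthonormal_frame_def)
  have on: "\<And>a b. a < ?m \<Longrightarrow> b < ?m \<Longrightarrow> g p (e a p) (e b p) = (if a = b then 1 else 0)"
    and sp: "span ((\<lambda>a. e a p) ` {..<?m}) = tangent_space A p"
    using frame p dim by (simp_all add: local_orthonormal_frame_def)
  have D: "metric_connection A g D" and Dg: "metric_connection A g Dg"
    using assms(2,3) by (simp_all add: characteristic_connection_def levi_civita_def)
  have D_eq: "D X Y = Dg X Y + (1 / 2) *\<^sub>R torsion D X Y"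
    if "X \<in> vector_fields A" "Y \<in> vector_fields A" for X Y
    using assms(3) that unfolding characteristic_connection_def by blast
  have summand: "g p (curvature D (e a) (e b) (e b) p) (e a p)
      = g p (curvature Dg (e a) (e b) (e b) p) (e a p)
        - g p (P.\<tau> p (e a p) (e b p)) (P.\<tau> p (e a p) (e b p)) / 4"
    if a: "a < ?m" and b: "b < ?m" for a b
  proof -
    let ?t = "torsion D (e a) (e b) p" and ?\<tau> = "P.\<tau> p (e a p) (e b p)"
    have t: "?t \<in> tangent_space A p"
    proof -
      have *: "D (e a) (e b) p \<in> tangent_space A p" "Dg (e a) (e b) p \<in> tangent_space A p"
        using metric_connection_closed[OF D e[OF a] e[OF b]]
          metric_connection_closed[OF Dg e[OF a] e[OF b]] by (simp_all add: tangent)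
      \<comment> \<open>Solving the defining equation of \<open>D\<close> for its torsion exhibits
        it as a tangent vector.\<close>
      have "?t = 2 *\<^sub>R (D (e a) (e b) p - Dg (e a) (e b) p)"
        using D_eq[OF e[OF a] e[OF b]] by simp
      then show ?thesis using * by (simp add: P.V_closed)
    qed
    have \<tau>: "?\<tau> \<in> tangent_space A p"
      using a b by (simp add: P.\<tau>_V tangent e)
    \<comment> \<open>The identity \<open>torsion_\<tau>\<close> concerns pairings with vector
      fields. The frame consists of such fields, so equal components give equal norms.\<close>
    have "g p ?t ?t = (\<Sum>c<?m. g p ?t (e c p) * g p ?t (e c p))"
      by (rule P.parseval[OF on sp t t, symmetric])
    also have "\<dots> = (\<Sum>c<?m. g p ?\<tau> (e c p) * g p ?\<tau> (e c p))"
      using a b e by (intro sum.cong refl) (simp add: torsion_\<tau>)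
    also have "\<dots> = g p ?\<tau> ?\<tau>"
      by (rule P.parseval[OF on sp \<tau> \<tau>])
    finally have "g p ?t ?t = g p ?\<tau> ?\<tau>" .
    moreover have "g p (curvature D (e a) (e b) (e b) p) (e a p)
        = g p (curvature Dg (e a) (e b) (e b) p) (e a p) - g p ?t ?t / 4"
      by (rule curvature_skew_torsion[OF atlas metric assms(2) D D_eq skew e[OF a] e[OF b]])
    ultimately show ?thesis by simp
  qed
  have "scalar_curvature g D ?m e p = (\<Sum>a<?m. \<Sum>b<?m.
      g p (curvature Dg (e a) (e b) (e b) p) (e a p)
      - g p (P.\<tau> p (e a p) (e b p)) (P.\<tau> p (e a p) (e b p)) / 4)"
    unfolding scalar_curvature_def ricci_def by (intro sum.cong refl) (simp add: summand)
  also have "\<dots> = scalar_curvature g Dg ?m e p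
      - (\<Sum>a<?m. \<Sum>b<?m. g p (P.\<tau> p (e a p) (e b p)) (P.\<tau> p (e a p) (e b p))) / 4"
    by (simp only: sum_subtractf sum_divide_distrib scalar_curvature_def ricci_def)
  \<comment> \<open>Here \<open>?m - s\<close> is 2n, so the sum is 24ns and a quarter of it is
    6ns.\<close>
  also have "(\<Sum>a<?m. \<Sum>b<?m. g p (P.\<tau> p (e a p) (e b p)) (P.\<tau> p (e a p) (e b p)))
      = 12 * real s * (real ?m - real s)"
    by (rule P.sum_\<tau>[OF on sp])
  finally show "scalar_curvature g D ?m e p
      = scalar_curvature g Dg ?m e p - 6 * real n * real s" by simp
qed

end
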